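(* Let $\Omega$ be a compact domain in $\mathbb{R}^n$ and let $g:\partial\Omega\to\mathbb{R}$ be bounded. Let $u:\Omega\to\mathbb{R}$ be the convex envelope of the boundary data $g$. For any point $x$ inside $\Omega$, let $P^x$ be a supporting plane to $u$ at $x$ and let $C^x=\{y\in\Omega\mid u(y)=P^x(y)\}$ be its contact set. Then: (1) $C^x$ is convex. (2) $C^x$ intersects the boundary of $\Omega$. (3) $C^x$ contains a line segment connecting $x$ to a point on the boundary of $\Omega$. (4) $C^x$ is the convex hull of $C^x\cap\partial\Omega$.
   Context: The convex envelope of the boundary data $g$ is $$u(x)=\sup\{v(x)\mid v\text{ convex},\ v(y)\le g(y)\ \text{for all }y\in\partial\Omega\},$$ where a function $v:\mathbb{R}^n\to\mathbb{R}$ is convex if $v(tx+(1-t)y)\le t\,v(x)+(1-t)v(y)$ for all $x,y\in\mathbb{R}^n$ and $0\le t\le1$. A supporting plane (supporting hyperplane) to $u$ at $x$ is an affine function $P^x(z)=u(x)+p\cdot(z-x)$, for some $p\in\mathbb{R}^n$, such that $u\ge P^x$ on the domain of $u$ (and $u(x)=P^x(x)$). If there is more than one supporting plane at $x$, the contact set may depend on the choice of $P^x$.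
   Formalization: Parts (1) and (4) are proved for convex Ω only: for any nonconvex Ω with interior points, e.g. a closed annulus, g = 0 gives u = 0, and P = 0 has contact set all of Ω, so both fail. Parts (2) and (3) are proved for every compact domain. *)

theory Defs
  imports "HOL-Analysis.Analysis"
begin

text \<open>
  Boundary data is a total function \<open>g\<close> whose values matter only on \<open>frontier \<Omega>\<close>.
  The supremum is that of the reals, so it is only meaningful where the set is nonempty and
  bounded above. This holds at every point of \<open>\<Omega>\<close> when \<open>\<Omega>\<close> is compact and \<open>g\<close> is bounded on
  \<open>frontier \<Omega>\<close>: a lower bound of \<open>g\<close> is a competitor, and each point of \<open>\<Omega>\<close> lies on a segment
  with end points in \<open>frontier \<Omega>\<close>.
\<close>

definition convex_envelope :: "(real ^ 'n) set \<Rightarrow> (real ^ 'n \<Rightarrow> real) \<Rightarrow> real ^ 'n \<Rightarrow> real" where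
  "convex_envelope \<Omega> g x =
     Sup {v x | v. convex_on UNIV v \<and> (\<forall>y\<in>frontier \<Omega>. v y \<le> g y)}"

definition supporting_plane ::
  "(real ^ 'n) set \<Rightarrow> (real ^ 'n \<Rightarrow> real) \<Rightarrow> real ^ 'n \<Rightarrow> (real ^ 'n \<Rightarrow> real) \<Rightarrow> bool" where
  "supporting_plane \<Omega> u x P \<longleftrightarrow>
     (\<exists>p. \<forall>z. P z = u x + p \<bullet> (z - x)) \<and> (\<forall>z\<in>\<Omega>. u z \<ge> P z)"

definition contact_set ::
  "(real ^ 'n) set \<Rightarrow> (real ^ 'n \<Rightarrow> real) \<Rightarrow> (real ^ 'n \<Rightarrow> real) \<Rightarrow> (real ^ 'n) set" where
  "contact_set \<Omega> u P = {y \<in> \<Omega>. u y = P y}"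

end

theory Submission imports Defs begin

text \<open>
  Call a convex function on the whole space that lies below \<open>g\<close> on the boundary a minorant; the
  envelope \<open>u\<close> is the pointwise supremum of the minorants. A supporting plane \<open>P\<close> satisfies
  \<open>P \<le> u \<le> g\<close> on the boundary, so it is itself a minorant, and therefore \<open>P \<le> u\<close> holds on the
  whole convex hull of the boundary and not only on \<open>\<Omega>\<close>.

  Everything rests on \<open>contact_point_in_hull_of_boundary_contact\<close>: a point where \<open>u\<close> touches a
  minorant \<open>P\<close> lies in the convex hull of the set \<open>Z\<close> of boundary points where they touch.
  Otherwise a hyperplane separates the point strictly from that hull, say by an affine function
  \<open>l\<close> that is positive at the point and negative on \<open>Z\<close>. On the part of the boundary where
  \<open>l \<ge> 0\<close>, which is compact and misses \<open>Z\<close>, the gap \<open>u - P\<close> is bounded below by a positive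
  constant, because \<open>u\<close> is a supremum of continuous functions. So \<open>P + \<epsilon> * l\<close> is still a minorant
  for small \<open>\<epsilon> > 0\<close>, and it exceeds \<open>P = u\<close> at the point, a contradiction. This never compares
  \<open>u\<close> with \<open>g\<close> beyond \<open>u \<le> g\<close>, which is why discontinuous boundary data are harmless.

  The four claims follow. As a supremum of convex functions \<open>u\<close> is convex, so \<open>u \<le> P\<close> on every
  segment between contact points, which makes the contact set convex when \<open>\<Omega>\<close> is. The hull of
  \<open>Z\<close> contains \<open>x\<close>, so \<open>Z\<close> has an element; the segment from \<open>x\<close> to it, cut off where it first
  reaches the boundary, is the required one. The hull formula is the key lemma applied at every
  point of the contact set.
\<close>

definition minorant :: "(real ^ 'n) set \<Rightarrow> (real ^ 'n \<Rightarrow> real) \<Rightarrow> (real ^ 'n \<Rightarrow> real) \<Rightarrow> bool" where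
  "minorant \<Omega> g v \<longleftrightarrow> convex_on UNIV v \<and> (\<forall>y\<in>frontier \<Omega>. v y \<le> g y)"

lemma convex_envelope_minorant: "convex_envelope \<Omega> g x = Sup {v x | v. minorant \<Omega> g v}"
  by (simp add: convex_envelope_def minorant_def)

lemma convex_on_affine: "convex_on UNIV (\<lambda>z::'a::real_inner. a + p \<bullet> z)"
proof (rule convex_onI)
  fix t :: real and x y :: 'a
  have "(1 - t) * a + t * a = a" by (simp add: algebra_simps)
  then show "a + p \<bullet> ((1 - t) *\<^sub>R x + t *\<^sub>R y) \<le> (1 - t) * (a + p \<bullet> x) + t * (a + p \<bullet> y)"
    by (simp add: inner_add_right distrib_left)
qed simp

lemma continuous_minorant:
  assumes "minorant \<Omega> g v" shows "continuous_on UNIV v"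
  using assms by (auto simp: minorant_def intro: convex_on_continuous)

text \<open>
  Through a point that is not on the boundary, a line leaves \<open>\<Omega>\<close> in both directions.
\<close>

lemma subset_hull_frontier:
  fixes \<Omega> :: "(real ^ 'n) set"
  assumes "compact \<Omega>"
  shows "\<Omega> \<subseteq> convex hull frontier \<Omega>"
proof
  fix x assume x: "x \<in> \<Omega>"
  show "x \<in> convex hull frontier \<Omega>"
  proof (cases "x \<in> frontier \<Omega>")
    case True then show ?thesis by (rule hull_inc)
  next
    case False
    then have i: "x \<in> interior \<Omega>"
      using x closure_subset by (auto simp: frontier_def)
    obtain l :: "real ^ 'n" where l: "l \<noteq> 0"
      using nonempty_Basis nonzero_Basis by blast
    obtain d where d: "0 < d" "x + d *\<^sub>R l \<in> frontier \<Omega>"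
      using ray_to_frontier[OF compact_imp_bounded[OF assms] i l] by blast
    obtain e where e: "0 < e" "x + e *\<^sub>R (- l) \<in> frontier \<Omega>"
      using ray_to_frontier[OF compact_imp_bounded[OF assms] i, of "- l"] l by auto
    have sum1: "e / (d + e) + d / (d + e) = 1"
      using d(1) e(1) by (metis add.commute add_divide_distrib add_pos_pos divide_self less_irrefl)
    have "(e / (d + e)) *\<^sub>R (x + d *\<^sub>R l) + (d / (d + e)) *\<^sub>R (x + e *\<^sub>R (- l))
        = (e / (d + e) + d / (d + e)) *\<^sub>R x"
      by (simp add: algebra_simps)
    also have "\<dots> = x"
      using sum1 by (simp only: scaleR_one)
    finally have eq: "(e / (d + e)) *\<^sub>R (x + d *\<^sub>R l) + (d / (d + e)) *\<^sub>R (x + e *\<^sub>R (- l)) = x" .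
    have "(e / (d + e)) *\<^sub>R (x + d *\<^sub>R l) + (d / (d + e)) *\<^sub>R (x + e *\<^sub>R (- l))
        \<in> convex hull frontier \<Omega>"
      using d e sum1 by (intro convexD[OF convex_convex_hull] hull_inc) auto
    then show ?thesis by (simp only: eq)
  qed
qed

text \<open>
  Real suprema carry information only for sets bounded above. The hull of the boundary is where
  this is guaranteed, since a convex function attains there no value above its boundary bound.
\<close>

lemma bdd_above_minorants:
  assumes "bounded (g ` frontier \<Omega>)" and "x \<in> convex hull frontier \<Omega>"
  shows "bdd_above {v x | v. minorant \<Omega> g v}"
proof -
  obtain M where M: "\<And>y. y \<in> frontier \<Omega> \<Longrightarrow> g y \<le> M"
    using bounded_imp_bdd_above[OF assms(1)] by (auto simp: bdd_above_def)
  have "v x \<le> M" if "minorant \<Omega> g v" for v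
  proof -
    have "convex_on (convex hull frontier \<Omega>) v"
      using that by (auto simp: minorant_def intro: convex_on_subset convex_convex_hull)
    moreover have "\<forall>y\<in>frontier \<Omega>. v y \<le> M"
      using that M by (fastforce simp: minorant_def)
    ultimately show ?thesis
      using convex_on_convex_hull_bound assms(2) by blast
  qed
  then show ?thesis by (auto simp: bdd_above_def)
qed

lemma minorant_le_envelope:
  assumes "bounded (g ` frontier \<Omega>)" and "x \<in> convex hull frontier \<Omega>" and "minorant \<Omega> g v"
  shows "v x \<le> convex_envelope \<Omega> g x"
  unfolding convex_envelope_minorant
  by (rule cSup_upper[OF _ bdd_above_minorants[OF assms(1,2)]]) (use assms(3) in blast)

lemma ex_minorant:
  fixes g :: "real ^ 'n \<Rightarrow> real"
  assumes "bounded (g ` frontier \<Omega>)"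
  shows "\<exists>v. minorant \<Omega> g v"
proof -
  obtain m where "\<And>y. y \<in> frontier \<Omega> \<Longrightarrow> m \<le> g y"
    using bounded_imp_bdd_below[OF assms] by (auto simp: bdd_below_def)
  then have "minorant \<Omega> g (\<lambda>_. m)"
    using convex_on_affine[of m 0] by (simp add: minorant_def)
  then show ?thesis by blast
qed

lemma envelope_le:
  assumes "bounded (g ` frontier \<Omega>)" and "\<And>v. minorant \<Omega> g v \<Longrightarrow> v x \<le> c"
  shows "convex_envelope \<Omega> g x \<le> c"
  unfolding convex_envelope_minorant
  by (rule cSup_least) (use ex_minorant[OF assms(1)] assms(2) in auto)

lemma envelope_le_boundary_data:
  assumes "bounded (g ` frontier \<Omega>)" and "y \<in> frontier \<Omega>"
  shows "convex_envelope \<Omega> g y \<le> g y"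
  by (rule envelope_le[OF assms(1)]) (use assms(2) in \<open>auto simp: minorant_def\<close>)

lemma convex_on_envelope:
  assumes "bounded (g ` frontier \<Omega>)"
  shows "convex_on (convex hull frontier \<Omega>) (convex_envelope \<Omega> g)"
proof (rule convex_onI)
  fix t x y assume t: "0 < t" "t < (1::real)"
    and x: "x \<in> convex hull frontier \<Omega>" and y: "y \<in> convex hull frontier \<Omega>"
  show "convex_envelope \<Omega> g ((1 - t) *\<^sub>R x + t *\<^sub>R y)
      \<le> (1 - t) * convex_envelope \<Omega> g x + t * convex_envelope \<Omega> g y"
  proof (rule envelope_le[OF assms])
    fix v assume v: "minorant \<Omega> g v"
    have "v ((1 - t) *\<^sub>R x + t *\<^sub>R y) \<le> (1 - t) * v x + t * v y"
      using v t by (intro convex_onD[where A = UNIV]) (auto simp: minorant_def)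
    also have "\<dots> \<le> (1 - t) * convex_envelope \<Omega> g x + t * convex_envelope \<Omega> g y"
      using t minorant_le_envelope[OF assms x v] minorant_le_envelope[OF assms y v]
      by (intro add_mono mult_left_mono) auto
    finally show "v ((1 - t) *\<^sub>R x + t *\<^sub>R y)
      \<le> (1 - t) * convex_envelope \<Omega> g x + t * convex_envelope \<Omega> g y" .
  qed
qed simp

text \<open>
  A positive gap \<open>u - P\<close> at a point is already witnessed by one minorant, hence, by continuity,
  with almost the same size on a neighbourhood. So lower bounds of the gap hold on open sets.
\<close>

lemma open_gap:
  assumes "minorant \<Omega> g P"
  shows "open (\<Union>v\<in>Collect (minorant \<Omega> g). {y. P y + c < v y})"
  using continuous_minorant assms
  by (intro open_UN ballI open_Collect_less continuous_intros) auto

lemma uniform_gap: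
  assumes g: "bounded (g ` frontier \<Omega>)" and P: "minorant \<Omega> g P"
    and F: "compact F" "F \<subseteq> convex hull frontier \<Omega>"
    and gap: "\<And>y. y \<in> F \<Longrightarrow> P y < convex_envelope \<Omega> g y"
  shows "\<exists>\<delta>>0. \<forall>y\<in>F. P y + \<delta> \<le> convex_envelope \<Omega> g y"
proof -
  define W where
    "W n = (\<Union>v\<in>Collect (minorant \<Omega> g). {y. P y + inverse (real (Suc n)) < v y})" for n
  have "F \<subseteq> (\<Union>n. W n)"
  proof
    fix y assume "y \<in> F"
    then obtain v where v: "minorant \<Omega> g v" "P y < v y"
      using gap envelope_le[OF g, of y "P y"] by (meson not_le)
    then obtain n where "inverse (real (Suc n)) < v y - P y"
      using reals_Archimedean[of "v y - P y"] by auto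
    then have "P y + inverse (real (Suc n)) < v y" by linarith
    then have "y \<in> W n" using v(1) unfolding W_def by blast
    then show "y \<in> (\<Union>n. W n)" by blast
  qed
  then obtain I where I: "finite I" "F \<subseteq> (\<Union>n\<in>I. W n)"
    using compactE_image[OF F(1), of UNIV W] open_gap[OF P] by (auto simp: W_def)
  define N where "N = Max (insert 0 I)"
  have "P y + inverse (real (Suc N)) \<le> convex_envelope \<Omega> g y" if y: "y \<in> F" for y
  proof -
    obtain n v where n: "n \<in> I" and v: "minorant \<Omega> g v" "P y + inverse (real (Suc n)) < v y"
      using subsetD[OF I(2) y] unfolding W_def by blast
    have "n \<le> N" using I(1) n by (simp add: N_def)
    then have "inverse (real (Suc N)) \<le> inverse (real (Suc n))"
      by (intro le_imp_inverse_le) auto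
    moreover have "v y \<le> convex_envelope \<Omega> g y"
      using minorant_le_envelope[OF g _ v(1)] F(2) y by blast
    ultimately show ?thesis using v(2) by linarith
  qed
  then show ?thesis by (intro exI[of _ "inverse (real (Suc N))"]) auto
qed

text \<open>
  Closedness makes the hull of the boundary contact points compact, so that a point outside it can
  be separated strictly.
\<close>

lemma closed_boundary_contact:
  assumes g: "bounded (g ` frontier \<Omega>)" and P: "minorant \<Omega> g P"
  shows "closed {y \<in> frontier \<Omega>. convex_envelope \<Omega> g y = P y}"
proof -
  have "{y \<in> frontier \<Omega>. convex_envelope \<Omega> g y = P y}
      = frontier \<Omega> - (\<Union>v\<in>Collect (minorant \<Omega> g). {y. P y + 0 < v y})"
  proof (intro equalityI subsetI)
    fix y assume "y \<in> {y \<in> frontier \<Omega>. convex_envelope \<Omega> g y = P y}"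
    then show "y \<in> frontier \<Omega> - (\<Union>v\<in>Collect (minorant \<Omega> g). {y. P y + 0 < v y})"
      using minorant_le_envelope[OF g hull_inc] by fastforce
  next
    fix y assume y: "y \<in> frontier \<Omega> - (\<Union>v\<in>Collect (minorant \<Omega> g). {y. P y + 0 < v y})"
    then have "convex_envelope \<Omega> g y \<le> P y"
      by (intro envelope_le[OF g]) (auto simp: not_less)
    then show "y \<in> {y \<in> frontier \<Omega>. convex_envelope \<Omega> g y = P y}"
      using y minorant_le_envelope[OF g hull_inc P] by fastforce
  qed
  then show ?thesis using open_gap[OF P, of 0] by (simp only: closed_Diff frontier_closed)
qed

text \<open>
  If the point were outside the hull, tilting \<open>P\<close> slightly upwards on its side of a separating
  hyperplane would give a minorant above \<open>u\<close> there.
\<close>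

lemma contact_point_in_hull_of_boundary_contact:
  fixes \<Omega> :: "(real ^ 'n) set"
  assumes "compact \<Omega>" and g: "bounded (g ` frontier \<Omega>)" and P: "minorant \<Omega> g P"
    and x: "x \<in> convex hull frontier \<Omega>" and touch: "convex_envelope \<Omega> g x = P x"
  shows "x \<in> convex hull {y \<in> frontier \<Omega>. convex_envelope \<Omega> g y = P y}" (is "x \<in> convex hull ?Z")
proof (rule ccontr)
  assume out: "x \<notin> convex hull ?Z"
  have cf: "compact (frontier \<Omega>)" using assms(1) by (rule compact_frontier)
  have "compact ?Z"
    using compact_Int_closed[OF cf closed_boundary_contact[OF g P]]
    by (rule back_subst[where P = compact]) blast
  then have "closed (convex hull ?Z)" by (intro compact_imp_closed compact_convex_hull)
  then obtain a b where sep: "a \<bullet> x < b" "\<And>y. y \<in> ?Z \<Longrightarrow> b < a \<bullet> y"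
    using separating_hyperplane_closed_point[OF convex_convex_hull _ out] hull_inc[of _ ?Z convex]
    by blast
  define F where "F = frontier \<Omega> \<inter> {y. a \<bullet> y \<le> b}"
  have "compact F" unfolding F_def
    by (intro compact_Int_closed cf closed_halfspace_le)
  moreover have "F \<subseteq> convex hull frontier \<Omega>" by (auto simp: F_def hull_inc)
  moreover have "P y < convex_envelope \<Omega> g y" if "y \<in> F" for y
  proof -
    have "y \<in> frontier \<Omega>" "y \<notin> ?Z" using that sep(2)[of y] by (auto simp: F_def)
    then show ?thesis using minorant_le_envelope[OF g hull_inc P, of y] by fastforce
  qed
  ultimately obtain \<delta> where \<delta>: "\<delta> > 0" "\<And>y. y \<in> F \<Longrightarrow> P y + \<delta> \<le> convex_envelope \<Omega> g y"
    using uniform_gap[OF g P] by meson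
  have "bounded ((\<lambda>y. b - a \<bullet> y) ` frontier \<Omega>)"
    by (intro compact_imp_bounded compact_continuous_image continuous_intros cf)
  then obtain M where M: "M > 0" "\<And>y. y \<in> frontier \<Omega> \<Longrightarrow> b - a \<bullet> y \<le> M"
    by (auto simp: bounded_pos) (metis abs_le_D1)
  \<comment> \<open>On \<open>F\<close> the tilt adds at most \<open>\<epsilon> * M = \<delta>\<close>; on the rest of the boundary it lowers \<open>P\<close>.\<close>
  define \<epsilon> where "\<epsilon> = \<delta> / M"
  have \<epsilon>: "\<epsilon> > 0" using \<delta> M by (simp add: \<epsilon>_def)
  define v where "v y = P y + \<epsilon> * (b - a \<bullet> y)" for y
  have v: "minorant \<Omega> g v"
    unfolding minorant_def
  proof
    have "v = (\<lambda>y. P y + (\<epsilon> * b + (- \<epsilon> *\<^sub>R a) \<bullet> y))"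
      by (auto simp: v_def algebra_simps)
    then show "convex_on UNIV v"
      using P convex_on_affine[of "\<epsilon> * b" "- \<epsilon> *\<^sub>R a"]
      by (simp add: minorant_def convex_on_add)
    show "\<forall>y\<in>frontier \<Omega>. v y \<le> g y"
    proof
      fix y assume y: "y \<in> frontier \<Omega>"
      show "v y \<le> g y"
      proof (cases "a \<bullet> y \<le> b")
        case True
        have "\<epsilon> * (b - a \<bullet> y) \<le> \<epsilon> * M" using \<epsilon> M(2)[OF y] by (intro mult_left_mono) auto
        also have "\<dots> = \<delta>" using M(1) by (simp add: \<epsilon>_def)
        finally have "v y \<le> P y + \<delta>" by (simp add: v_def)
        then show ?thesis
          using \<delta>(2)[of y] True y envelope_le_boundary_data[OF g y] by (simp add: F_def)
      next
        case False
        then have "\<epsilon> * (b - a \<bullet> y) \<le> 0" using \<epsilon> by (intro mult_nonneg_nonpos) auto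
        moreover have "P y \<le> g y" using P y by (simp add: minorant_def)
        ultimately show ?thesis by (simp add: v_def)
      qed
    qed
  qed
  have "P x < v x" using \<epsilon> sep(1) by (simp add: v_def)
  then show False using minorant_le_envelope[OF g x v] touch by simp
qed

lemma supporting_plane_minorant:
  assumes "closed \<Omega>" and g: "bounded (g ` frontier \<Omega>)"
    and "supporting_plane \<Omega> (convex_envelope \<Omega> g) x P"
  shows "minorant \<Omega> g P"
  unfolding minorant_def
proof
  obtain p where p: "\<And>z. P z = convex_envelope \<Omega> g x + p \<bullet> (z - x)"
    and below: "\<And>z. z \<in> \<Omega> \<Longrightarrow> P z \<le> convex_envelope \<Omega> g z"
    using assms(3) by (auto simp: supporting_plane_def)
  have "P = (\<lambda>z. (convex_envelope \<Omega> g x - p \<bullet> x) + p \<bullet> z)"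
    by (auto simp: p inner_diff_right)
  then show "convex_on UNIV P" by (simp only: convex_on_affine)
  show "\<forall>y\<in>frontier \<Omega>. P y \<le> g y"
    using below envelope_le_boundary_data[OF g] frontier_subset_closed[OF assms(1)]
    by (meson order_trans subsetD)
qed

text \<open>
  The contact set within the whole hull of the boundary is convex even for nonconvex \<open>\<Omega>\<close>; this
  form serves both the convexity of the contact set and the segment from \<open>x\<close> to the boundary.
\<close>

lemma convex_contact_in_hull:
  assumes "closed \<Omega>" and g: "bounded (g ` frontier \<Omega>)"
    and sp: "supporting_plane \<Omega> (convex_envelope \<Omega> g) x P"
  shows "convex {y \<in> convex hull frontier \<Omega>. convex_envelope \<Omega> g y = P y}"
proof (rule convexI)
  fix y z and s t :: real
  let ?u = "convex_envelope \<Omega> g"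
  assume y: "y \<in> {y \<in> convex hull frontier \<Omega>. ?u y = P y}"
    and z: "z \<in> {y \<in> convex hull frontier \<Omega>. ?u y = P y}"
    and st: "0 \<le> s" "0 \<le> t" "s + t = 1"
  obtain p where p: "\<And>z. P z = ?u x + p \<bullet> (z - x)"
    using sp by (auto simp: supporting_plane_def)
  have s: "s = 1 - t" using st by simp
  have mem: "s *\<^sub>R y + t *\<^sub>R z \<in> convex hull frontier \<Omega>"
    using y z st by (intro convexD[OF convex_convex_hull]) auto
  have "?u (s *\<^sub>R y + t *\<^sub>R z) \<le> s * ?u y + t * ?u z"
    unfolding s using convex_onD[OF convex_on_envelope[OF g], of t y z] y z st by auto
  also have "\<dots> = s * P y + t * P z" using y z by simp
  also have "\<dots> = P (s *\<^sub>R y + t *\<^sub>R z)" by (simp add: p s algebra_simps)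
  finally show "s *\<^sub>R y + t *\<^sub>R z \<in> {y \<in> convex hull frontier \<Omega>. ?u y = P y}"
    using mem minorant_le_envelope[OF g mem supporting_plane_minorant[OF assms]] by simp
qed

theorem theorem3p2:
  fixes \<Omega> C :: "(real ^ 'n) set"
    and g u P :: "real ^ 'n \<Rightarrow> real"
    and x :: "real ^ 'n"
  assumes "compact \<Omega>" and "connected \<Omega>"
    and "bounded (g ` frontier \<Omega>)"
    and "u = convex_envelope \<Omega> g"
    and "x \<in> interior \<Omega>"
    and "supporting_plane \<Omega> u x P"
    and "C = contact_set \<Omega> u P"
  shows "(convex \<Omega> \<longrightarrow> convex C) \<and>
    C \<inter> frontier \<Omega> \<noteq> {} \<and>
    (\<exists>y\<in>frontier \<Omega>. closed_segment x y \<subseteq> C) \<and>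
    (convex \<Omega> \<longrightarrow> C = convex hull (C \<inter> frontier \<Omega>))"
proof -
  note g = assms(3)
  have closed: "closed \<Omega>" using assms(1) by (rule compact_imp_closed)
  have sp: "supporting_plane \<Omega> (convex_envelope \<Omega> g) x P" using assms(4,6) by simp
  have P: "minorant \<Omega> g P" by (rule supporting_plane_minorant[OF closed g sp])
  have fr: "frontier \<Omega> \<subseteq> \<Omega>" by (rule frontier_subset_closed[OF closed])
  define D where "D = {y \<in> convex hull frontier \<Omega>. u y = P y}"
  have D: "convex D"
    using convex_contact_in_hull[OF closed g sp] by (simp add: D_def assms(4))
  have C: "C = \<Omega> \<inter> D"
    using subset_hull_frontier[OF assms(1)] by (auto simp: assms(7) contact_set_def D_def)
  have Z: "{y \<in> frontier \<Omega>. u y = P y} = C \<inter> frontier \<Omega>"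
    using fr by (auto simp: C D_def hull_inc)
  have hull: "z \<in> convex hull (C \<inter> frontier \<Omega>)" if "z \<in> C" for z
    using contact_point_in_hull_of_boundary_contact[OF assms(1) g P, of z] that
    unfolding Z[symmetric] by (simp add: C D_def assms(4))

  have convex: "convex C" if "convex \<Omega>"
    using that D unfolding C by (rule convex_Int)

  have xC: "x \<in> C"
    using assms(5,6) interior_subset by (auto simp: assms(7) contact_set_def supporting_plane_def)
  have nonempty: "C \<inter> frontier \<Omega> \<noteq> {}" using hull[OF xC] by auto

  have segment: "\<exists>y\<in>frontier \<Omega>. closed_segment x y \<subseteq> C"
  proof -
    obtain y where y: "y \<in> C" "y \<in> frontier \<Omega>" using nonempty by blast
    then have "y - x \<noteq> 0" using assms(5) by (auto simp: frontier_def)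
    then obtain d where d: "0 < d" "x + d *\<^sub>R (y - x) \<in> frontier \<Omega>"
      and inside: "\<And>e. \<lbrakk>0 \<le> e; e < d\<rbrakk> \<Longrightarrow> x + e *\<^sub>R (y - x) \<in> interior \<Omega>"
      using ray_to_frontier[OF compact_imp_bounded[OF assms(1)] assms(5)] by metis
    \<comment> \<open>The boundary is reached at \<open>y\<close> at the latest, so the cut-off segment stays within \<open>[x, y]\<close>.\<close>
    have "d \<le> 1"
      using inside[of 1] y(2) by (fastforce simp: frontier_def)
    have "closed_segment x (x + d *\<^sub>R (y - x)) \<subseteq> C"
    proof
      fix z assume "z \<in> closed_segment x (x + d *\<^sub>R (y - x))"
      then obtain t where t: "0 \<le> t" "t \<le> 1"
        and "z = (1 - t) *\<^sub>R x + t *\<^sub>R (x + d *\<^sub>R (y - x))"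
        by (auto simp: in_segment)
      then have z: "z = x + (t * d) *\<^sub>R (y - x)" by (simp add: algebra_simps)
      have td: "0 \<le> t * d" "t * d \<le> d"
        using t d(1) by (auto simp: mult_left_le_one_le)
      have "z \<in> \<Omega>"
        using inside[of "t * d"] td d(2) fr interior_subset unfolding z
        by (cases "t * d = d") fastforce+
      moreover have "z \<in> D"
      proof -
        have "z = (1 - t * d) *\<^sub>R x + (t * d) *\<^sub>R y" by (simp add: z algebra_simps)
        then show ?thesis
          using convexD[OF D, of x y "1 - t * d" "t * d"] xC y(1) td \<open>d \<le> 1\<close> by (auto simp: C)
      qed
      ultimately show "z \<in> C" by (simp add: C)
    qed
    then show ?thesis using d(2) by blast
  qed

  have "C = convex hull (C \<inter> frontier \<Omega>)" if "convex \<Omega>"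
    using hull hull_minimal[of "C \<inter> frontier \<Omega>" C convex] convex[OF that] by auto
  with convex nonempty segment show ?thesis by blast
qed

end
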